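(* Let $X\subseteq\mathbb C$ be a semiclassical Swiss cheese set. Then the uniform algebra $R(X)$ is essential.
   Context: For an open or closed disc $D$ in $\mathbb C$, $r(D)$ denotes its radius; a disc has positive finite radius. A Swiss cheese is a pair $\mathbf D=(\Delta,\mathcal D)$ where $\Delta$ is a compact (closed) disc in $\mathbb C$ and $\mathcal D$ is a countable or finite collection (set) of open discs in $\mathbb C$. The associated Swiss cheese set is $X_{\mathbf D}:=\Delta\setminus\bigcup\mathcal D$. $\mathbf D=(\Delta,\mathcal D)$ is semiclassical if the discs in $\mathcal D$ intersect neither one another (distinct members are disjoint) nor $\mathbb C\setminus\Delta$, if $\overline D\subsetneq\Delta$ for each $D\in\mathcal D$, and if $\sum_{D\in\mathcal D}r(D)<\infty$. A set $X\subseteq\mathbb C$ is a semiclassical Swiss cheese set if $X=X_{\mathbf D}$ for some semiclassical Swiss cheese $\mathbf D$. For a non-empty compact set $X\subseteq\mathbb C$, $C(X)$ is the algebra of continuous functions $X\to\mathbb C$ with the supremum norm; $R_0(X)$ is the subalgebra of functions $g|_X$ where $g:\mathbb C\to\mathbb C\cup\{\infty\}$ is a rational function with $\infty\notin g(X)$; and $R(X)$ is the supremum-norm closure of $R_0(X)$ in $C(X)$. A uniform algebra on a compact Hausdorff space $X$ is a closed subalgebra of $C(X)$ containing the constants and separating the points of $X$. A uniform algebra $A$ on $X$ is essential if, for each closed, non-empty, proper subset $Y$ of $X$, there is a function $f\in C(X)\setminus A$ such that $f|_Y=0$. *)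

theory Defs
  imports "HOL-Analysis.Analysis" "HOL-Computational_Algebra.Polynomial"
begin

subsection \<open>Swiss cheeses\<close>

definition disc_radius :: "complex set \<Rightarrow> real" where
  "disc_radius D = (THE r. r > 0 \<and> (\<exists>c. D = ball c r \<or> D = cball c r))"

definition open_disc :: "complex set \<Rightarrow> bool" where
  "open_disc D \<longleftrightarrow> (\<exists>c r. r > 0 \<and> D = ball c r)"

definition closed_disc :: "complex set \<Rightarrow> bool" where
  "closed_disc D \<longleftrightarrow> (\<exists>c r. r > 0 \<and> D = cball c r)"

definition swiss_cheese :: "complex set \<times> complex set set \<Rightarrow> bool" where
  "swiss_cheese = (\<lambda>(\<Delta>, \<D>). closed_disc \<Delta> \<and> countable \<D> \<and> (\<forall>D\<in>\<D>. open_disc D))"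

definition cheese_set :: "complex set \<times> complex set set \<Rightarrow> complex set" where
  "cheese_set = (\<lambda>(\<Delta>, \<D>). \<Delta> - \<Union>\<D>)"

definition semiclassical :: "complex set \<times> complex set set \<Rightarrow> bool" where
  "semiclassical = (\<lambda>(\<Delta>, \<D>).
     disjoint \<D> \<and>
     (\<forall>D\<in>\<D>. D \<inter> (- \<Delta>) = {}) \<and>
     (\<forall>D\<in>\<D>. closure D \<subset> \<Delta>) \<and>
     disc_radius summable_on \<D>)"

definition semiclassical_swiss_cheese_set :: "complex set \<Rightarrow> bool" where
  "semiclassical_swiss_cheese_set X \<longleftrightarrow>
     (\<exists>C. swiss_cheese C \<and> semiclassical C \<and> X = cheese_set C)"

subsection \<open>Uniform algebras\<close>

text \<open>Functions on a space are represented as extensional functions on its carrier. The boundedness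
  built into \<^const>\<open>cfunspace\<close> is automatic on compact spaces, so for compact \<open>X\<close> the following is
  \<open>C(X)\<close> with the metric of the supremum norm.\<close>

abbreviation C_metric :: "'a topology \<Rightarrow> ('a \<Rightarrow> complex) metric" where
  "C_metric X \<equiv> cfunspace X euclidean_metric"

abbreviation C_space :: "'a topology \<Rightarrow> ('a \<Rightarrow> complex) set" where
  "C_space X \<equiv> mspace (C_metric X)"

definition subalgebra_on :: "'a topology \<Rightarrow> ('a \<Rightarrow> complex) set \<Rightarrow> bool" where
  "subalgebra_on X A \<longleftrightarrow>
     A \<noteq> {} \<and> A \<subseteq> C_space X \<and>
     (\<forall>f\<in>A. \<forall>g\<in>A. (\<lambda>x\<in>topspace X. f x + g x) \<in> A) \<and>
     (\<forall>c. \<forall>f\<in>A. (\<lambda>x\<in>topspace X. c * f x) \<in> A) \<and>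
     (\<forall>f\<in>A. \<forall>g\<in>A. (\<lambda>x\<in>topspace X. f x * g x) \<in> A)"

definition uniform_algebra :: "'a topology \<Rightarrow> ('a \<Rightarrow> complex) set \<Rightarrow> bool" where
  "uniform_algebra X A \<longleftrightarrow>
     compact_space X \<and> Hausdorff_space X \<and>
     subalgebra_on X A \<and>
     closedin (mtopology_of (C_metric X)) A \<and>
     (\<forall>c. (\<lambda>x\<in>topspace X. c) \<in> A) \<and>
     (\<forall>x\<in>topspace X. \<forall>y\<in>topspace X. x \<noteq> y \<longrightarrow> (\<exists>f\<in>A. f x \<noteq> f y))"

definition essential :: "'a topology \<Rightarrow> ('a \<Rightarrow> complex) set \<Rightarrow> bool" where
  "essential X A \<longleftrightarrow>
     (\<forall>Y. closedin X Y \<and> Y \<noteq> {} \<and> Y \<noteq> topspace X \<longrightarrow>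
        (\<exists>f \<in> C_space X - A. \<forall>y\<in>Y. f y = 0))"

subsection \<open>The algebra R(X)\<close>

text \<open>A rational function is finite everywhere on \<open>X\<close> iff it can be written as \<open>p / q\<close> with \<open>q\<close>
  having no zero on \<open>X\<close> (e.g. in lowest terms).\<close>

definition R0 :: "complex set \<Rightarrow> (complex \<Rightarrow> complex) set" where
  "R0 X = {(\<lambda>z\<in>X. poly p z / poly q z) | p q. q \<noteq> 0 \<and> (\<forall>z\<in>X. poly q z \<noteq> 0)}"

definition R_alg :: "complex set \<Rightarrow> (complex \<Rightarrow> complex) set" where
  "R_alg X = mtopology_of (C_metric (top_of_set X)) closure_of R0 X"

end

theory Submission
  imports Defs "HOL-Complex_Analysis.Residue_Theorem"
begin

text \<open>
  \<open>R(X)\<close> is a uniform algebra for every compact \<open>X\<close>: the rational functions without poles on \<open>X\<close>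
  form an algebra containing the polynomials, and sums and products of bounded functions respect
  uniform convergence. Essentiality is where the geometry of the cheese enters. Given a closed
  proper subset \<open>Y\<close> of \<open>X\<close>, choose \<open>a \<in> X\<close> and \<open>e > 0\<close> such that \<open>ball a e\<close> misses \<open>Y\<close>; it is enough
  to find a bounded functional \<open>\<Lambda>\<close> on \<open>C(X)\<close> that annihilates \<open>R(X)\<close>, and a continuous \<open>f\<close> vanishing
  off \<open>ball a e\<close> with \<open>\<Lambda> f \<noteq> 0\<close> (\<open>essential_R_algI\<close>).

  Write \<open>\<Delta>\<close> for the large disc and \<open>D\<close> for the removed ones. The functional that does most of the
  work is integration over the oriented boundary circles of \<open>X\<close>,
  \<open>bint f = \<integral>\<^bsub>\<partial>\<Delta>\<^esub> f dz - (\<Sum>D. \<integral>\<^bsub>\<partial>D\<^esub> f dz)\<close>. It is bounded because the sum of the radii is finite.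
  It annihilates every rational function \<open>g\<close> with poles off \<open>X\<close>: by the residue theorem, a circle
  contributes the residues of \<open>g\<close> inside it, and a pole in \<open>\<Delta>\<close> lies in exactly one of the disjoint discs
  \<open>D\<close>, so its residue is added once and subtracted once (\<open>annihilator_bint\<close>).

  Suppose that \<open>ball a e\<close> meets one of the boundary circles, say \<open>C\<close> with centre \<open>c\<close>. The function
  \<open>\<psi> z = max 0 (e - dist a z) * cnj (z - c)\<close> lives in the ball and has a non-zero integral over \<open>C\<close>,
  since \<open>cnj (z - c) dz\<close> is a constant multiple of arc length there. The other circles must be kept
  from cancelling this contribution. They can accumulate at every point of \<open>C\<close>, but each of them meets
  \<open>C\<close> in finitely many points only. So multiply \<open>\<psi>\<close> by cut-off functions decreasing to the indicator
  function of \<open>C\<close>: by dominated convergence, first on each circle and then in the sum over the circles,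
  \<open>bint\<close> tends to plus or minus the integral of \<open>\<psi>\<close> over \<open>C\<close>, hence is non-zero for some cut-off
  (\<open>bint_nonzero\<close>).

  If \<open>ball a e\<close> meets no boundary circle, then by connectedness it is contained in \<open>X\<close>. Such interior
  points do occur, for instance when no disc is removed. Functions in \<open>R(X)\<close> are then holomorphic
  near \<open>a\<close>, and the integral over a small circle about \<open>a\<close> is the annihilating functional.
\<close>

section \<open>Contour integrals over circles\<close>

text \<open>
  On the circle \<open>cmod w = r\<close> one has \<open>cnj w = r\<^sup>2 / w\<close>, which turns the equation of the second circle
  into a quadratic equation for \<open>w\<close>.
\<close>

lemma finite_sphere_Int_sphere:
  fixes c c' :: complex
  assumes "r > 0" "r' > 0" "(c, r) \<noteq> (c', r')"
  shows "finite (sphere c r \<inter> sphere c' r')"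
proof -
  define d where "d = c - c'"
  define p where "p = [:d * of_real (r^2), of_real (r^2 + (cmod d)^2 - r'^2), cnj d:]"
  have "p \<noteq> 0"
  proof
    assume "p = 0"
    then have "d = 0" "of_real (r^2 + (cmod d)^2 - r'^2) = (0::complex)"
      by (auto simp: p_def)
    then have "c = c'" "r^2 = r'^2"
      by (auto simp del: of_real_diff of_real_add simp add: d_def)
    with assms show False
      by (simp add: power2_eq_iff_nonneg)
  qed
  have "poly p (z - c) = 0" if "z \<in> sphere c r \<inter> sphere c' r'" for z
  proof -
    define w where "w = z - c"
    have "cmod w = r" "cmod (w + d) = r'"
      using that by (auto simp: w_def d_def dist_norm norm_minus_commute)
    then have 1: "w * cnj w = of_real (r^2)" and 2: "(w + d) * cnj (w + d) = of_real (r'^2)"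
      by (simp_all only: complex_norm_square [symmetric])
    have 3: "of_real ((cmod d)^2) = d * cnj d"
      by (rule complex_norm_square)
    have "poly p w = d * of_real (r^2) + w * (of_real (r^2) + of_real ((cmod d)^2) - of_real (r'^2) + w * cnj d)"
      by (simp add: p_def)
    also have "\<dots> = 0"
      unfolding 1[symmetric] 2[symmetric] 3 by (simp add: algebra_simps)
    finally show ?thesis
      by (simp add: w_def)
  qed
  then have "sphere c r \<inter> sphere c' r' \<subseteq> (\<lambda>w. w + c) ` {w. poly p w = 0}"
    by (force simp: image_iff intro: exI[of _ "_ - c"])
  then show ?thesis
    using poly_roots_finite[OF \<open>p \<noteq> 0\<close>] by (meson finite_imageI finite_subset)
qed

lemma circlepath_in_sphere:
  assumes "r > 0"
  shows "circlepath c r t \<in> sphere c r"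
  using assms by (simp add: circlepath dist_norm norm_mult)

lemma continuous_on_circlepath:
  assumes "r > 0" "continuous_on (sphere c r) \<phi>"
  shows "continuous_on {0..1} (\<lambda>t. \<phi> (circlepath c r t))"
proof (rule continuous_on_compose2[OF assms(2)])
  show "continuous_on {0..1} (circlepath c r)"
    using path_circlepath[of c r] by (simp add: path_def)
qed (use circlepath_in_sphere[OF assms(1)] in blast)

lemma finite_circlepath_preimage:
  assumes "r \<noteq> 0" "finite S"
  shows "finite {t \<in> {0..1}. circlepath c r t \<in> S}"
proof -
  have "inj_on (circlepath c r) {0<..<1}"
    using simple_path_circlepath[of c r] assms(1)
    by (force simp: simple_path_def loop_free_def inj_on_def)
  then have "finite (circlepath c r -` S \<inter> {0<..<1})"
    using assms(2) by (rule finite_vimage_IntI[rotated])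
  then have "finite (insert 0 (insert 1 (circlepath c r -` S \<inter> {0<..<1})))"
    by simp
  then show ?thesis
    by (rule rev_finite_subset) auto
qed

lemma circle_integral_bound:
  assumes "r > 0" "continuous_on (sphere c r) f" "\<And>z. z \<in> sphere c r \<Longrightarrow> cmod (f z) \<le> B"
  shows "cmod (contour_integral (circlepath c r) f) \<le> B * (2 * pi * r)"
proof (rule has_contour_integral_bound_circlepath)
  show "(f has_contour_integral contour_integral (circlepath c r) f) (circlepath c r)"
    using assms by (intro has_contour_integral_integral contour_integrable_continuous_circlepath) simp
  have "c + of_real r \<in> sphere c r"
    using assms(1) by (simp add: dist_norm)
  from assms(3)[OF this] show "0 \<le> B"
    using norm_ge_zero order_trans by blast
qed (use assms in \<open>auto simp: dist_norm norm_minus_commute\<close>)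

lemma circle_integral_diff:
  assumes "r > 0" "continuous_on (sphere c r) f" "continuous_on (sphere c r) g"
  shows "contour_integral (circlepath c r) (\<lambda>z. f z - g z)
       = contour_integral (circlepath c r) f - contour_integral (circlepath c r) g"
  using assms by (intro contour_integral_diff contour_integrable_continuous_circlepath) auto

text \<open>
  Along the circle, \<open>dz = \<i> (z - c) d\<theta>\<close> and \<open>(z - c) * cnj (z - c) = r\<^sup>2\<close>, so the factor
  \<open>cnj (z - c)\<close> turns the contour integral into an integral against arc length.
\<close>

lemma circle_integral_weight:
  assumes "r > 0" and phi: "continuous_on (sphere c r) \<phi>"
  shows "contour_integral (circlepath c r) (\<lambda>z. of_real (\<phi> z) * cnj (z - c))
       = 2 * pi * \<i> * of_real (r^2 * integral {0..1} (\<lambda>t. \<phi> (circlepath c r t)))"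
proof -
  have cont: "continuous_on {0..1} (\<lambda>t. \<phi> (circlepath c r t))"
    by (rule continuous_on_circlepath[OF assms(1) phi])
  have "contour_integral (circlepath c r) (\<lambda>z. of_real (\<phi> z) * cnj (z - c))
      = integral {0..1} (\<lambda>t. of_real (\<phi> (circlepath c r t)) * cnj (circlepath c r t - c) *
          vector_derivative (circlepath c r) (at t))"
    by (rule contour_integral_integral)
  also have "\<dots> = integral {0..1} (\<lambda>t. (2 * pi * \<i> * of_real (r^2)) * of_real (\<phi> (circlepath c r t)))"
  proof (rule integral_cong)
    fix t :: real
    assume t: "t \<in> {0..1}"
    define e where "e = exp (2 * of_real pi * \<i> * of_real t)"
    have 1: "circlepath c r t - c = of_real r * e"
      by (simp add: circlepath e_def)
    have "cmod e = 1"
      by (simp add: e_def)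
    then have "cnj e * e = 1"
      by (simp add: mult.commute flip: complex_norm_square)
    then have "cnj (of_real r * e) * (2 * pi * \<i> * r * e) = 2 * pi * \<i> * of_real (r^2)"
      by (simp add: power2_eq_square algebra_simps)
    then show "of_real (\<phi> (circlepath c r t)) * cnj (circlepath c r t - c) *
          vector_derivative (circlepath c r) (at t)
        = (2 * pi * \<i> * of_real (r^2)) * of_real (\<phi> (circlepath c r t))"
      using t by (simp add: 1 vector_derivative_circlepath flip: e_def)
  qed
  also have "\<dots> = (2 * pi * \<i> * of_real (r^2)) * integral {0..1} (\<lambda>t. of_real (\<phi> (circlepath c r t)))"
    by simp
  also have "integral {0..1} (\<lambda>t. complex_of_real (\<phi> (circlepath c r t)))
           = of_real (integral {0..1} (\<lambda>t. \<phi> (circlepath c r t)))"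
    using integral_linear[OF integrable_continuous_real[OF cont] bounded_linear_of_real]
    by (simp add: o_def)
  finally show ?thesis
    by simp
qed

lemma circle_integral_weight_nonzero:
  assumes "r > 0" and phi: "continuous_on (sphere c r) \<phi>"
    and nonneg: "\<And>z. z \<in> sphere c r \<Longrightarrow> \<phi> z \<ge> 0"
    and b: "b \<in> sphere c r" "\<phi> b > 0"
  shows "contour_integral (circlepath c r) (\<lambda>z. of_real (\<phi> z) * cnj (z - c)) \<noteq> 0"
proof -
  have cont: "continuous_on {0..1} (\<lambda>t. \<phi> (circlepath c r t))"
    by (rule continuous_on_circlepath[OF assms(1) phi])
  have "b \<in> path_image (circlepath c r)"
    using b \<open>r > 0\<close> by simp
  then obtain t where "t \<in> {0..1}" "b = circlepath c r t"
    unfolding path_image_def by blast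
  then have "integral {0..1} (\<lambda>t. \<phi> (circlepath c r t)) \<noteq> 0"
    using integral_eq_0_iff[OF cont] nonneg[OF circlepath_in_sphere[OF assms(1)]] b by force
  then show ?thesis
    using \<open>r > 0\<close> by (subst circle_integral_weight[OF assms(1,2)]) simp
qed

text \<open>
  The cut-off functions tend pointwise to the indicator function of \<open>sphere c r\<close>. On any other circle
  that indicator function vanishes outside a finite set, so in the limit only the circle
  \<open>sphere c r\<close> itself is seen.
\<close>

lemma tendsto_circle_integral_spike:
  assumes "r > 0" "r' > 0" and phi: "continuous_on UNIV \<phi>"
  shows "(\<lambda>k::nat. contour_integral (circlepath c' r')
            (\<lambda>z. \<phi> z * of_real (max 0 (1 - real k * \<bar>dist c z - r\<bar>))))
       \<longlonglongrightarrow> (if (c', r') = (c, r) then contour_integral (circlepath c r) \<phi> else 0)"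
proof -
  define \<gamma> where "\<gamma> = circlepath c' r'"
  define F where "F = (\<lambda>(k::nat) t. \<phi> (\<gamma> t) * of_real (max 0 (1 - real k * \<bar>dist c (\<gamma> t) - r\<bar>)) *
     (2 * pi * \<i> * r' * exp (2 * of_real pi * \<i> * of_real t)))"
  define G where "G = (\<lambda>t. (if \<gamma> t \<in> sphere c r then \<phi> (\<gamma> t) else 0) *
     (2 * pi * \<i> * r' * exp (2 * of_real pi * \<i> * of_real t)))"
  have g_cont: "continuous_on {0..1} \<gamma>"
    using path_circlepath path_def \<gamma>_def by blast
  have phi_g: "continuous_on {0..1} (\<lambda>t. \<phi> (\<gamma> t))"
    by (rule continuous_on_compose2[OF phi g_cont]) auto
  have CI: "contour_integral (circlepath c' r') f
      = integral {0..1} (\<lambda>t. f (\<gamma> t) * (2 * pi * \<i> * r' * exp (2 * of_real pi * \<i> * of_real t)))" for f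
    unfolding contour_integral_integral \<gamma>_def
    by (rule integral_cong) (simp add: vector_derivative_circlepath)
  have "(\<lambda>k. integral {0..1} (F k)) \<longlonglongrightarrow> integral {0..1} G"
  proof (rule dominated_convergence)
    show "F k integrable_on {0..1}" for k
      unfolding F_def by (intro integrable_continuous_real continuous_intros phi_g g_cont)
    show "(\<lambda>t. cmod (\<phi> (\<gamma> t)) * (2 * pi * r')) integrable_on {0..1}"
      by (intro integrable_continuous_real continuous_intros phi_g)
    show "cmod (F k t) \<le> cmod (\<phi> (\<gamma> t)) * (2 * pi * r')" for k t
    proof -
      have "cmod (F k t) = cmod (\<phi> (\<gamma> t)) * \<bar>max 0 (1 - real k * \<bar>dist c (\<gamma> t) - r\<bar>)\<bar> * (2 * pi * r')"
        using \<open>r' > 0\<close> by (simp add: F_def norm_mult)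
      also have "\<dots> \<le> cmod (\<phi> (\<gamma> t)) * 1 * (2 * pi * r')"
        using \<open>r' > 0\<close> by (intro mult_right_mono mult_left_mono) auto
      finally show ?thesis by simp
    qed
    show "(\<lambda>k. F k t) \<longlonglongrightarrow> G t" for t
    proof (cases "\<gamma> t \<in> sphere c r")
      case True
      then show ?thesis by (simp add: F_def G_def)
    next
      case False
      then have pos: "\<bar>dist c (\<gamma> t) - r\<bar> > 0"
        by auto
      obtain N :: nat where N: "real N * \<bar>dist c (\<gamma> t) - r\<bar> > 1"
        using reals_Archimedean3[OF pos] by blast
      have "F k t = G t" if "k \<ge> N" for k
      proof -
        have "real N * \<bar>dist c (\<gamma> t) - r\<bar> \<le> real k * \<bar>dist c (\<gamma> t) - r\<bar>"
          using that by (intro mult_right_mono) auto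
        then have "max 0 (1 - real k * \<bar>dist c (\<gamma> t) - r\<bar>) = 0"
          using N by linarith
        then show ?thesis
          using False by (simp add: F_def G_def)
      qed
      then show ?thesis
        by (metis (mono_tags, lifting) eventually_sequentially tendsto_eventually)
    qed
  qed
  moreover have "integral {0..1} G = (if (c', r') = (c, r) then contour_integral (circlepath c r) \<phi> else 0)"
  proof (cases "(c', r') = (c, r)")
    case True
    then have "\<gamma> t \<in> sphere c r" for t
      unfolding \<gamma>_def using True circlepath_in_sphere[OF \<open>r > 0\<close>] by simp
    then show ?thesis
      using True CI[of \<phi>] by (simp add: G_def)
  next
    case False
    then have fin: "finite (sphere c r \<inter> sphere c' r')"
      using finite_sphere_Int_sphere[of r r' c c'] assms by auto
    have "\<gamma> t \<in> sphere c' r'" for t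
      unfolding \<gamma>_def by (rule circlepath_in_sphere[OF \<open>r' > 0\<close>])
    then have "G t = 0" if "t \<in> {0..1} - {t \<in> {0..1}. circlepath c' r' t \<in> sphere c r \<inter> sphere c' r'}" for t
      using that by (auto simp: G_def \<gamma>_def)
    with finite_circlepath_preimage[OF _ fin, of r' c'] \<open>r' > 0\<close> have "(G has_integral 0) {0..1}"
      by (intro has_integral_spike_finite[of _ "{0..1}" G "\<lambda>_. 0"]) auto
    with False show ?thesis by auto
  qed
  ultimately show ?thesis
    by (simp add: CI F_def)
qed

text \<open>
  The residue theorem in a form where the index set of the sum, all zeros of the denominator, does not
  depend on the circle. Integrals over many circles can then be added up zero by zero; the summand at
  a zero where the fraction stays bounded is \<open>0\<close>.
\<close>

lemma circle_integral_rational: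
  fixes p q :: "complex poly"
  assumes "r > 0" "q \<noteq> 0" and nz: "\<And>z. z \<in> sphere c r \<Longrightarrow> poly q z \<noteq> 0"
  shows "contour_integral (circlepath c r) (\<lambda>z. poly p z / poly q z)
       = 2 * pi * \<i> * (\<Sum>w | poly q w = 0. (if w \<in> ball c r then 1 else 0) *
            residue (\<lambda>z. poly p z / poly q z) w)"
proof -
  have "contour_integral (circlepath c r) (\<lambda>z. poly p z / poly q z)
      = 2 * pi * \<i> * (\<Sum>w | poly q w = 0. winding_number (circlepath c r) w *
            residue (\<lambda>z. poly p z / poly q z) w)"
  proof (rule Residue_theorem[of UNIV])
    show "finite {w. poly q w = 0}"
      by (rule poly_roots_finite[OF \<open>q \<noteq> 0\<close>])
    show "(\<lambda>z. poly p z / poly q z) holomorphic_on UNIV - {w. poly q w = 0}"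
      by (intro holomorphic_intros) auto
    show "path_image (circlepath c r) \<subseteq> UNIV - {w. poly q w = 0}"
      using assms by auto
  qed auto
  also have "(\<Sum>w | poly q w = 0. winding_number (circlepath c r) w *
            residue (\<lambda>z. poly p z / poly q z) w)
      = (\<Sum>w | poly q w = 0. (if w \<in> ball c r then 1 else 0) *
            residue (\<lambda>z. poly p z / poly q z) w)"
  proof (rule sum.cong)
    fix w assume w: "w \<in> {w. poly q w = 0}"
    have "winding_number (circlepath c r) w = (if w \<in> ball c r then 1 else 0)"
    proof (cases "w \<in> ball c r")
      case True
      then show ?thesis
        by (auto simp: dist_norm norm_minus_commute intro: winding_number_circlepath)
    next
      case False
      with w nz[of w] have "w \<notin> cball c r"
        by (auto simp: order_less_le)
      with \<open>r > 0\<close> have "winding_number (circlepath c r) w = 0"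
        by (intro winding_number_zero_outside[of _ "cball c r"]) auto
      with False show ?thesis by simp
    qed
    then show "winding_number (circlepath c r) w * residue (\<lambda>z. poly p z / poly q z) w
             = (if w \<in> ball c r then 1 else 0) * residue (\<lambda>z. poly p z / poly q z) w"
      by simp
  qed auto
  finally show ?thesis .
qed

section \<open>The uniform algebra of uniform limits of rational functions\<close>

lemma C_space_top_of_set:
  fixes X :: "complex set"
  assumes "compact X"
  shows "C_space (top_of_set X) = {f \<in> extensional X. continuous_on X f}"
proof -
  have "bounded (f ` X)" if "continuous_on X f" for f :: "complex \<Rightarrow> complex"
    by (rule compact_imp_bounded[OF compact_continuous_image[OF that assms]])
  then show ?thesis
    by (auto simp: continuous_map_iff_continuous2)
qed

lemma restrict_in_C_space:
  fixes X :: "complex set"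
  assumes "compact X" "continuous_on X f"
  shows "restrict f X \<in> C_space (top_of_set X)"
  using assms(2) by (simp del: mspace_cfunspace add: C_space_top_of_set[OF assms(1)] cong: continuous_on_cong)

lemma R0_subset_C_space:
  assumes "compact X"
  shows "R0 X \<subseteq> C_space (top_of_set X)"
  unfolding R0_def using assms
  by (auto intro!: restrict_in_C_space continuous_intros simp del: mspace_cfunspace)

text \<open>
  Membership in the topological closure \<^const>\<open>R_alg\<close> is uniform approximability on \<open>X\<close>. The version with
  an error bound suits the estimates for functionals; the one with sequences below reduces the algebra
  operations to uniform limits of sums and products.
\<close>

lemma R_alg_iff:
  assumes X: "compact X"
  shows "f \<in> R_alg X \<longleftrightarrow> f \<in> C_space (top_of_set X) \<and>
           (\<forall>e>0. \<exists>g\<in>R0 X. \<forall>x\<in>X. cmod (f x - g x) \<le> e)"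
proof -
  have le: "mdist (C_metric (top_of_set X)) f g \<le> e \<longleftrightarrow> (\<forall>x\<in>X. cmod (f x - g x) \<le> e)"
    if "f \<in> C_space (top_of_set X)" "g \<in> R0 X" "e > 0" for f g and e :: real
  \<comment> \<open>\<open>cfunspace_mdist_le\<close> requires a non-empty space.\<close>
  proof (cases "X = {}")
    case True
    then show ?thesis
      using that mdist_cfunspace_le[of e "top_of_set X" euclidean_metric f g] by auto
  next
    case False
    then show ?thesis
      using cfunspace_mdist_le[of f "top_of_set X" euclidean_metric g e] that R0_subset_C_space[OF X]
      by (auto simp: dist_norm simp del: mspace_cfunspace)
  qed
  have "f \<in> R_alg X \<longleftrightarrow> f \<in> C_space (top_of_set X) \<and>
     (\<forall>e>0. \<exists>g\<in>R0 X. f \<in> C_space (top_of_set X) \<and> g \<in> C_space (top_of_set X) \<and>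
        mdist (C_metric (top_of_set X)) f g \<le> e)"
    unfolding R_alg_def mtopology_of_def
      Metric_space.metric_closure_of_alt[OF Metric_space_mspace_mdist]
      Metric_space.in_mcball[OF Metric_space_mspace_mdist]
    by auto
  then show ?thesis
    using le R0_subset_C_space[OF X] by (meson subsetD)
qed

lemma R_alg_iff_uniform_limit:
  assumes X: "compact X"
  shows "f \<in> R_alg X \<longleftrightarrow> f \<in> C_space (top_of_set X) \<and>
           (\<exists>s. (\<forall>n. s n \<in> R0 X) \<and> uniform_limit X s f sequentially)"
proof -
  have "(\<forall>e>0. \<exists>g\<in>R0 X. \<forall>x\<in>X. cmod (f x - g x) \<le> e) \<longleftrightarrow>
        (\<exists>s. (\<forall>n. s n \<in> R0 X) \<and> uniform_limit X s f sequentially)" (is "?L \<longleftrightarrow> ?R")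
  proof
    assume ?L
    then have "\<forall>n. \<exists>g\<in>R0 X. \<forall>x\<in>X. cmod (f x - g x) \<le> inverse (real (Suc n))"
      by (meson inverse_positive_iff_positive of_nat_0_less_iff zero_less_Suc)
    then obtain s where s: "\<And>n. s n \<in> R0 X"
      "\<And>n x. x \<in> X \<Longrightarrow> cmod (f x - s n x) \<le> inverse (real (Suc n))"
      by metis
    have "uniform_limit X s f sequentially"
    proof (rule uniform_limitI)
      fix e :: real
      assume "e > 0"
      then have "\<forall>\<^sub>F n in sequentially. inverse (real (Suc n)) < e"
        by (rule order_tendstoD(2)[OF LIMSEQ_inverse_real_of_nat])
      then show "\<forall>\<^sub>F n in sequentially. \<forall>x\<in>X. dist (s n x) (f x) < e"
      proof eventually_elim
        case (elim n)
        then show ?case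
          using s(2)[of _ n] by (metis dist_commute dist_norm order_le_less_trans)
      qed
    qed
    with s(1) show ?R
      by blast
  next
    assume ?R
    then obtain s where s: "\<And>n. s n \<in> R0 X" and lim: "uniform_limit X s f sequentially"
      by blast
    show ?L
    proof (intro allI impI)
      fix e :: real
      assume "e > 0"
      then have "\<forall>\<^sub>F n in sequentially. \<forall>x\<in>X. dist (s n x) (f x) < e"
        by (rule uniform_limitD[OF lim])
      then obtain n where "\<forall>x\<in>X. dist (s n x) (f x) < e"
        unfolding eventually_sequentially by blast
      then have "\<forall>x\<in>X. cmod (f x - s n x) \<le> e"
        by (metis dist_commute dist_norm less_imp_le)
      with s[of n] show "\<exists>g\<in>R0 X. \<forall>x\<in>X. cmod (f x - g x) \<le> e"
        by blast
    qed
  qed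
  then show ?thesis
    by (simp only: R_alg_iff[OF X])
qed

lemma R0_polynomial: "(\<lambda>z\<in>X. poly p z) \<in> R0 X"
  unfolding R0_def by (intro CollectI exI[of _ p] exI[of _ 1]) auto

lemma R0_add:
  assumes "f \<in> R0 X" "g \<in> R0 X"
  shows "(\<lambda>z\<in>X. f z + g z) \<in> R0 X"
proof -
  obtain p q where f: "f = (\<lambda>z\<in>X. poly p z / poly q z)" "q \<noteq> 0" "\<forall>z\<in>X. poly q z \<noteq> 0"
    using assms(1) by (auto simp: R0_def)
  obtain p' q' where g: "g = (\<lambda>z\<in>X. poly p' z / poly q' z)" "q' \<noteq> 0" "\<forall>z\<in>X. poly q' z \<noteq> 0"
    using assms(2) by (auto simp: R0_def)
  show ?thesis
    unfolding R0_def using f g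
    by (intro CollectI exI[of _ "p * q' + p' * q"] exI[of _ "q * q'"])
       (auto simp: fun_eq_iff restrict_def add_frac_eq)
qed

lemma R0_mult:
  assumes "f \<in> R0 X" "g \<in> R0 X"
  shows "(\<lambda>z\<in>X. f z * g z) \<in> R0 X"
proof -
  obtain p q where f: "f = (\<lambda>z\<in>X. poly p z / poly q z)" "q \<noteq> 0" "\<forall>z\<in>X. poly q z \<noteq> 0"
    using assms(1) by (auto simp: R0_def)
  obtain p' q' where g: "g = (\<lambda>z\<in>X. poly p' z / poly q' z)" "q' \<noteq> 0" "\<forall>z\<in>X. poly q' z \<noteq> 0"
    using assms(2) by (auto simp: R0_def)
  show ?thesis
    unfolding R0_def using f g
    by (intro CollectI exI[of _ "p * p'"] exI[of _ "q * q'"])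
       (auto simp: fun_eq_iff restrict_def)
qed

lemma R0_subset_R_alg:
  assumes "compact X"
  shows "R0 X \<subseteq> R_alg X"
  unfolding R_alg_def using R0_subset_C_space[OF assms]
  by (intro closure_of_subset) (simp del: mspace_cfunspace)

lemma uniform_algebra_R_alg:
  assumes X: "compact X"
  shows "uniform_algebra (top_of_set X) (R_alg X)"
proof -
  have R: "f \<in> C_space (top_of_set X) \<and> continuous_on X f \<and> bounded (f ` X) \<and>
           (\<exists>s. (\<forall>n. s n \<in> R0 X) \<and> uniform_limit X s f sequentially)" if "f \<in> R_alg X" for f
  proof -
    have C: "f \<in> C_space (top_of_set X)"
      and s: "\<exists>s. (\<forall>n. s n \<in> R0 X) \<and> uniform_limit X s f sequentially"
      using that unfolding R_alg_iff_uniform_limit[OF X] by blast+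
    from C have cont: "continuous_on X f"
      unfolding C_space_top_of_set[OF X] by blast
    then have "bounded (f ` X)"
      by (rule compact_imp_bounded[OF compact_continuous_image[OF _ X]])
    with C s cont show ?thesis by blast
  qed
  have poly: "(\<lambda>z\<in>X. poly p z) \<in> R_alg X" for p
    using R0_polynomial R0_subset_R_alg[OF X] by blast
  have add: "(\<lambda>z\<in>X. f z + g z) \<in> R_alg X" if f: "f \<in> R_alg X" and g: "g \<in> R_alg X" for f g
  proof -
    obtain s where s: "\<And>n. s n \<in> R0 X" "uniform_limit X s f sequentially"
      using R[OF f] by blast
    obtain t where t: "\<And>n. t n \<in> R0 X" "uniform_limit X t g sequentially"
      using R[OF g] by blast
    have "uniform_limit X (\<lambda>n z. s n z + t n z) (\<lambda>z. f z + g z) sequentially"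
      by (intro uniform_limit_add s t)
    then have "uniform_limit X (\<lambda>n. \<lambda>z\<in>X. s n z + t n z) (\<lambda>z\<in>X. f z + g z) sequentially"
      by (rule iffD1[OF uniform_limit_cong', rotated 2]) auto
    then show ?thesis
      unfolding R_alg_iff_uniform_limit[OF X] using R[OF f] R[OF g] s(1) t(1)
      by (intro conjI restrict_in_C_space X continuous_intros exI[of _ "\<lambda>n. \<lambda>z\<in>X. s n z + t n z"])
         (auto intro: R0_add)
  qed
  have mult: "(\<lambda>z\<in>X. f z * g z) \<in> R_alg X" if f: "f \<in> R_alg X" and g: "g \<in> R_alg X" for f g
  proof -
    obtain s where s: "\<And>n. s n \<in> R0 X" "uniform_limit X s f sequentially"
      using R[OF f] by blast
    obtain t where t: "\<And>n. t n \<in> R0 X" "uniform_limit X t g sequentially"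
      using R[OF g] by blast
    have "uniform_limit X (\<lambda>n z. s n z * t n z) (\<lambda>z. f z * g z) sequentially"
      using R[OF f] R[OF g] by (intro uniform_lim_mult s t) auto
    then have "uniform_limit X (\<lambda>n. \<lambda>z\<in>X. s n z * t n z) (\<lambda>z\<in>X. f z * g z) sequentially"
      by (rule iffD1[OF uniform_limit_cong', rotated 2]) auto
    then show ?thesis
      unfolding R_alg_iff_uniform_limit[OF X] using R[OF f] R[OF g] s(1) t(1)
      by (intro conjI restrict_in_C_space X continuous_intros exI[of _ "\<lambda>n. \<lambda>z\<in>X. s n z * t n z"])
         (auto intro: R0_mult)
  qed
  have const: "(\<lambda>z\<in>X. c) \<in> R_alg X" for c
    using poly[of "[:c:]"] by simp
  have cmult: "(\<lambda>z\<in>X. c * f z) \<in> R_alg X" if "f \<in> R_alg X" for c f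
    using mult[OF const[of c] that] by (simp cong: restrict_cong)
  have "subalgebra_on (top_of_set X) (R_alg X)"
    unfolding subalgebra_on_def using const R add mult cmult
    by (auto simp del: mspace_cfunspace)
  moreover have "\<exists>f\<in>R_alg X. f x \<noteq> f y" if "x \<in> X" "y \<in> X" "x \<noteq> y" for x y
    using poly[of "[:0, 1:]"] that by (intro bexI[of _ "\<lambda>z\<in>X. poly [:0, 1:] z"]) auto
  moreover have "closedin (mtopology_of (C_metric (top_of_set X))) (R_alg X)"
    unfolding R_alg_def by (rule closedin_closure_of)
  moreover have "compact_space (top_of_set X)"
    using X by (simp add: compact_space_subtopology)
  moreover have "Hausdorff_space (top_of_set X)"
    by (simp add: Hausdorff_space_subtopology)
  ultimately show ?thesis
    unfolding uniform_algebra_def using const by simp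
qed

section \<open>Functionals that annihilate rational functions\<close>

text \<open>
  The first condition is Lipschitz continuity for the supremum norm on \<open>X\<close>; for a linear functional it
  is boundedness. It allows \<open>\<Lambda>\<close> to be defined on all functions \<open>complex \<Rightarrow> complex\<close>, as contour
  integrals are: with \<open>e = 0\<close> it says that, for \<open>f\<close> continuous on \<open>X\<close>, \<open>\<Lambda> f\<close> depends only on the
  values of \<open>f\<close> on \<open>X\<close>.
\<close>

definition annihilator :: "complex set \<Rightarrow> ((complex \<Rightarrow> complex) \<Rightarrow> complex) \<Rightarrow> bool" where
  "annihilator X \<Lambda> \<longleftrightarrow>
     (\<exists>K. \<forall>f g e. continuous_on X f \<longrightarrow> continuous_on X g \<longrightarrow> (\<forall>z\<in>X. cmod (f z - g z) \<le> e) \<longrightarrow>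
        cmod (\<Lambda> f - \<Lambda> g) \<le> K * e) \<and>
     (\<forall>p q. q \<noteq> 0 \<longrightarrow> (\<forall>z\<in>X. poly q z \<noteq> 0) \<longrightarrow> \<Lambda> (\<lambda>z. poly p z / poly q z) = 0)"

text \<open>
  An element of \<open>R(X)\<close> is within any \<open>e > 0\<close> of a rational function, where \<open>\<Lambda>\<close> vanishes; let
  \<open>e\<close> tend to \<open>0\<close> in \<open>cmod (\<Lambda> f) \<le> K * e\<close>.
\<close>

lemma annihilator_R_alg:
  assumes X: "compact X" and ann: "annihilator X \<Lambda>"
    and f: "continuous_on X f" "restrict f X \<in> R_alg X"
  shows "\<Lambda> f = 0"
proof -
  have "\<exists>K. \<forall>f g e. continuous_on X f \<longrightarrow> continuous_on X g \<longrightarrow> (\<forall>z\<in>X. cmod (f z - g z) \<le> e) \<longrightarrow>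
        cmod (\<Lambda> f - \<Lambda> g) \<le> K * e"
    and rat: "\<forall>p q. q \<noteq> 0 \<longrightarrow> (\<forall>z\<in>X. poly q z \<noteq> 0) \<longrightarrow> \<Lambda> (\<lambda>z. poly p z / poly q z) = 0"
    using ann unfolding annihilator_def by simp_all
  then obtain K where K: "\<forall>f g e. continuous_on X f \<longrightarrow> continuous_on X g \<longrightarrow>
      (\<forall>z\<in>X. cmod (f z - g z) \<le> e) \<longrightarrow> cmod (\<Lambda> f - \<Lambda> g) \<le> K * e"
    by (elim exE)
  have bound: "cmod (\<Lambda> f) \<le> K * e" if "e > 0" for e
  proof -
    obtain g where g: "g \<in> R0 X" "\<And>z. z \<in> X \<Longrightarrow> cmod (f z - g z) \<le> e"
      using f(2) \<open>e > 0\<close> unfolding R_alg_iff[OF X] by (metis restrict_apply')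
    obtain p q where pq: "g = (\<lambda>z\<in>X. poly p z / poly q z)" "q \<noteq> 0" "\<forall>z\<in>X. poly q z \<noteq> 0"
      using g(1) by (auto simp: R0_def)
    have "cmod (\<Lambda> f - \<Lambda> (\<lambda>z. poly p z / poly q z)) \<le> K * e"
      using f(1) g(2) pq by (intro K[rule_format] continuous_intros) auto
    then show ?thesis
      using rat pq(2,3) by simp
  qed
  have "((\<lambda>e. K * e) \<longlongrightarrow> K * 0) (at_right 0)"
    by (intro tendsto_intros)
  moreover have "\<forall>\<^sub>F e in at_right 0. cmod (\<Lambda> f) \<le> K * e"
    using bound by (auto simp: eventually_at_right_field intro: exI[of _ 1])
  ultimately have "cmod (\<Lambda> f) \<le> K * 0"
    by (rule tendsto_lowerbound) simp
  then show ?thesis by simp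
qed

lemma essential_R_algI:
  assumes X: "compact X"
    and ann: "\<And>a e. a \<in> X \<Longrightarrow> e > 0 \<Longrightarrow> \<exists>\<Lambda> f. annihilator X \<Lambda> \<and> continuous_on X f \<and>
                (\<forall>z. z \<notin> ball a e \<longrightarrow> f z = 0) \<and> \<Lambda> f \<noteq> 0"
  shows "essential (top_of_set X) (R_alg X)"
  unfolding essential_def
proof (intro allI impI)
  fix Y
  assume Y: "closedin (top_of_set X) Y \<and> Y \<noteq> {} \<and> Y \<noteq> topspace (top_of_set X)"
  then have "closed Y" "Y \<subseteq> X"
    using closedin_closed_trans compact_imp_closed[OF X] closedin_imp_subset by blast+
  with Y obtain a where a: "a \<in> X" "a \<in> - Y"
    by auto
  with \<open>closed Y\<close> obtain e where e: "e > 0" "ball a e \<subseteq> - Y"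
    by (meson open_Compl open_contains_ball)
  obtain \<Lambda> f where f: "annihilator X \<Lambda>" "continuous_on X f"
      "\<And>z. z \<notin> ball a e \<Longrightarrow> f z = 0" "\<Lambda> f \<noteq> 0"
    using ann[OF a(1) e(1)] by blast
  have "restrict f X \<notin> R_alg X"
    using annihilator_R_alg[OF X f(1,2)] f(4) by blast
  moreover have "restrict f X y = 0" if "y \<in> Y" for y
  proof -
    have "y \<in> X" "y \<notin> ball a e"
      using that \<open>Y \<subseteq> X\<close> e(2) by blast+
    with f(3) show ?thesis by simp
  qed
  ultimately show "\<exists>f\<in>C_space (top_of_set X) - R_alg X. \<forall>y\<in>Y. f y = 0"
    using restrict_in_C_space[OF X f(2)] by blast
qed

text \<open>
  If the whole disc lies in \<open>X\<close>, a rational function without poles on \<open>X\<close> has no residue inside the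
  circle.
\<close>

lemma annihilator_circle_integral:
  assumes "r > 0" "cball a r \<subseteq> X"
  shows "annihilator X (contour_integral (circlepath a r))"
  unfolding annihilator_def
proof (intro conjI exI[of _ "2 * pi * r"] allI impI)
  fix f g e
  assume fg: "continuous_on X f" "continuous_on X g" "\<forall>z\<in>X. cmod (f z - g z) \<le> e"
  have sub: "sphere a r \<subseteq> X"
    using assms(2) by auto
  have cont: "continuous_on (sphere a r) f" "continuous_on (sphere a r) g"
    using fg sub continuous_on_subset by blast+
  have "cmod (contour_integral (circlepath a r) (\<lambda>z. f z - g z)) \<le> e * (2 * pi * r)"
    using fg(3) sub by (intro circle_integral_bound continuous_intros assms cont) auto
  then show "cmod (contour_integral (circlepath a r) f - contour_integral (circlepath a r) g)
      \<le> 2 * pi * r * e"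
    by (simp add: circle_integral_diff assms cont mult.commute)
next
  fix p q :: "complex poly"
  assume q: "q \<noteq> 0" "\<forall>z\<in>X. poly q z \<noteq> 0"
  have "w \<notin> ball a r" if "poly q w = 0" for w
    using that q(2) assms(2) ball_subset_cball[of a r] by blast
  then have "(\<Sum>w | poly q w = 0. (if w \<in> ball a r then 1 else 0) *
            residue (\<lambda>z. poly p z / poly q z) w) = 0"
    by (intro sum.neutral) auto
  moreover have "poly q z \<noteq> 0" if "z \<in> sphere a r" for z
    using that q(2) assms(2) by auto
  ultimately show "contour_integral (circlepath a r) (\<lambda>z. poly p z / poly q z) = 0"
    using circle_integral_rational[OF assms(1) q(1), of a p] by simp
qed

section \<open>Integration over the boundary of a Swiss cheese\<close>

text \<open>
  The removed discs are given by their centres and radii as functions of an index \<open>D \<in> \<D>\<close>, since the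
  boundary functional integrates over parametrised circles. Summability of the radii is phrased as
  integrability for the counting measure, so that sums over the discs can be exchanged with limits by
  the dominated convergence theorem. The assumption \<open>proper\<close> guarantees that no inner circle cancels
  the outer one; for this it is enough that the two circles differ, and tangency is possible.
\<close>

locale cheese_boundary =
  fixes c0 :: complex and r0 :: real and \<D> :: "'d set" and cen :: "'d \<Rightarrow> complex" and rad :: "'d \<Rightarrow> real"
  assumes r0: "r0 > 0"
    and rad: "\<And>D. D \<in> \<D> \<Longrightarrow> rad D > 0"
    and sub: "\<And>D. D \<in> \<D> \<Longrightarrow> ball (cen D) (rad D) \<subseteq> cball c0 r0"
    and proper: "\<And>D. D \<in> \<D> \<Longrightarrow> (cen D, rad D) \<noteq> (c0, r0)"
    and disj: "\<And>D E. D \<in> \<D> \<Longrightarrow> E \<in> \<D> \<Longrightarrow> D \<noteq> E \<Longrightarrow> ball (cen D) (rad D) \<inter> ball (cen E) (rad E) = {}"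
    and summable: "integrable (count_space \<D>) rad"
begin

definition X where "X = cball c0 r0 - (\<Union>D\<in>\<D>. ball (cen D) (rad D))"

lemma compact_X: "compact X"
  unfolding X_def by (intro compact_diff compact_cball) auto

text \<open>
  No boundary circle meets an open removed disc. For the outer circle this holds because an open subset
  of the large disc lies in its interior, for the inner ones because a disc disjoint from an open
  set has closure disjoint from it. Hence the boundary functional is defined on \<open>C(X)\<close>.
\<close>

lemma outer_circle_subset: "sphere c0 r0 \<subseteq> X"
proof -
  have "ball (cen D) (rad D) \<subseteq> ball c0 r0" if "D \<in> \<D>" for D
    using interior_mono[OF sub[OF that]] rad[OF that] by (simp add: interior_open)
  then show ?thesis
    by (fastforce simp: X_def)
qed

lemma inner_circle_subset:
  assumes D: "D \<in> \<D>"
  shows "sphere (cen D) (rad D) \<subseteq> X"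
proof -
  have "cball (cen D) (rad D) \<subseteq> cball c0 r0"
    using closure_mono[OF sub[OF D]] rad[OF D] by simp
  moreover have "sphere (cen D) (rad D) \<inter> ball (cen E) (rad E) = {}" if E: "E \<in> \<D>" for E
  proof (cases "D = E")
    case False
    then have "closure (ball (cen D) (rad D)) \<inter> ball (cen E) (rad E) = {}"
      using disj[OF D E] by (simp add: open_Int_closure_eq_empty Int_commute)
    then show ?thesis
      using rad[OF D] by (fastforce simp: disjoint_iff)
  qed auto
  ultimately show ?thesis
    unfolding X_def by fastforce
qed

text \<open>
  Integration of \<open>f dz\<close> over the boundary circles of \<open>X\<close>, oriented with \<open>X\<close> on the left.
\<close>

definition bint :: "(complex \<Rightarrow> complex) \<Rightarrow> complex" where
  "bint f = contour_integral (circlepath c0 r0) f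
    - (LINT D|count_space \<D>. contour_integral (circlepath (cen D) (rad D)) f)"

lemma integrable_inner:
  assumes f: "continuous_on X f"
  shows "integrable (count_space \<D>) (\<lambda>D. contour_integral (circlepath (cen D) (rad D)) f)"
proof -
  have "bounded (f ` X)"
    using f compact_X by (intro compact_imp_bounded compact_continuous_image)
  then obtain B where B: "\<And>z. z \<in> X \<Longrightarrow> cmod (f z) \<le> B"
    by (auto simp: bounded_iff)
  have "integrable (count_space \<D>) (\<lambda>D. B * (2 * pi) * rad D)"
    using summable by simp
  then show ?thesis
  proof (rule Bochner_Integration.integrable_bound)
    show "AE D in count_space \<D>. cmod (contour_integral (circlepath (cen D) (rad D)) f)
         \<le> norm (B * (2 * pi) * rad D)"
    proof (rule AE_I2)
      fix D assume "D \<in> space (count_space \<D>)"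
      then have D: "D \<in> \<D>" by simp
      have "cmod (contour_integral (circlepath (cen D) (rad D)) f) \<le> B * (2 * pi * rad D)"
        using B inner_circle_subset[OF D] continuous_on_subset[OF f]
        by (intro circle_integral_bound rad D) auto
      then show "cmod (contour_integral (circlepath (cen D) (rad D)) f) \<le> norm (B * (2 * pi) * rad D)"
        by (simp add: mult.assoc)
    qed
  qed simp
qed

text \<open>
  Boundedness is the finiteness of the total length of the circles; the vanishing on rational
  functions is a count of residues.
\<close>

lemma annihilator_bint: "annihilator X bint"
  unfolding annihilator_def
proof (intro conjI exI[of _ "2 * pi * (r0 + (LINT D|count_space \<D>. rad D))"] allI impI)
  fix f g e
  assume f: "continuous_on X f" and g: "continuous_on X g" and fg: "\<forall>z\<in>X. cmod (f z - g z) \<le> e"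
  let ?I = "\<lambda>D. contour_integral (circlepath (cen D) (rad D))"
  have B: "cmod (contour_integral (circlepath c r) f - contour_integral (circlepath c r) g)
        \<le> e * (2 * pi * r)"
    if "r > 0" "sphere c r \<subseteq> X" for c r
  proof -
    have cont: "continuous_on (sphere c r) f" "continuous_on (sphere c r) g"
      using f g that continuous_on_subset by blast+
    have "cmod (contour_integral (circlepath c r) (\<lambda>z. f z - g z)) \<le> e * (2 * pi * r)"
      using fg that(2) by (intro circle_integral_bound continuous_intros that cont) auto
    then show ?thesis
      by (simp add: circle_integral_diff that cont)
  qed
  have inner: "cmod (?I D f - ?I D g) \<le> e * (2 * pi * rad D)" if "D \<in> \<D>" for D
    by (rule B[OF rad[OF that] inner_circle_subset[OF that]])
  have "cmod ((LINT D|count_space \<D>. ?I D f) - (LINT D|count_space \<D>. ?I D g))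
      = cmod (LINT D|count_space \<D>. ?I D f - ?I D g)"
    by (simp add: integrable_inner f g)
  also have "\<dots> \<le> (LINT D|count_space \<D>. cmod (?I D f - ?I D g))"
    by (rule integral_norm_bound)
  also have "\<dots> \<le> (LINT D|count_space \<D>. e * (2 * pi * rad D))"
    using summable
    by (intro integral_mono integrable_norm Bochner_Integration.integrable_diff integrable_inner f g)
       (auto intro: inner)
  also have "\<dots> = e * (2 * pi * (LINT D|count_space \<D>. rad D))"
    by simp
  finally have 1: "cmod ((LINT D|count_space \<D>. ?I D f) - (LINT D|count_space \<D>. ?I D g))
       \<le> e * (2 * pi * (LINT D|count_space \<D>. rad D))" .
  have 2: "cmod (contour_integral (circlepath c0 r0) f - contour_integral (circlepath c0 r0) g)
      \<le> e * (2 * pi * r0)"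
    by (rule B[OF r0 outer_circle_subset])
  have "cmod ((contour_integral (circlepath c0 r0) f - contour_integral (circlepath c0 r0) g)
       - ((LINT D|count_space \<D>. ?I D f) - (LINT D|count_space \<D>. ?I D g)))
      \<le> e * (2 * pi * r0) + e * (2 * pi * (LINT D|count_space \<D>. rad D))"
    by (rule norm_triangle_le_diff[OF add_mono[OF 2 1]])
  then show "cmod (bint f - bint g) \<le> 2 * pi * (r0 + (LINT D|count_space \<D>. rad D)) * e"
    by (simp add: bint_def algebra_simps)
next
  fix p q :: "complex poly"
  assume q: "q \<noteq> 0" "\<forall>z\<in>X. poly q z \<noteq> 0"
  let ?f = "\<lambda>z. poly p z / poly q z"
  let ?Z = "{w. poly q w = 0}"
  let ?in = "\<lambda>w c r. if w \<in> ball c r then 1 else 0 :: complex"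
  have CI: "contour_integral (circlepath c r) ?f = 2 * pi * \<i> * (\<Sum>w\<in>?Z. ?in w c r * residue ?f w)"
    if "r > 0" "sphere c r \<subseteq> X" for c r
    using that q by (intro circle_integral_rational) auto
  \<comment> \<open>Among the removed discs, a pole belongs to exactly one if it lies in the large disc and to none
    otherwise, so the inner circles together wind around it as often as the outer one.\<close>
  have int: "integrable (count_space \<D>) (\<lambda>D. ?in w (cen D) (rad D))"
    and count: "(LINT D|count_space \<D>. ?in w (cen D) (rad D)) = ?in w c0 r0" if w: "w \<in> ?Z" for w
  proof -
    let ?S = "{D \<in> \<D>. w \<in> ball (cen D) (rad D)}"
    have uniq: "D = E" if "D \<in> ?S" "E \<in> ?S" for D E
      using that disj[of D E] by blast
    have S: "{D \<in> \<D>. ?in w (cen D) (rad D) \<noteq> 0} = ?S"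
      by auto
    have fin: "finite ?S"
    proof (cases "?S = {}")
      case False
      then obtain D where "D \<in> ?S"
        by blast
      with uniq have "?S \<subseteq> {D}"
        by blast
      then show ?thesis
        by (rule finite_subset) simp
    qed (simp only: finite.emptyI)
    then show "integrable (count_space \<D>) (\<lambda>D. ?in w (cen D) (rad D))"
    proof -
      have "Infinite_Set_Sum.abs_summable_on (\<lambda>D. ?in w (cen D) (rad D)) ?S"
        by (rule abs_summable_on_finite[OF fin])
      then have "Infinite_Set_Sum.abs_summable_on (\<lambda>D. ?in w (cen D) (rad D)) \<D>"
        by (rule iffD1[OF abs_summable_on_cong_neutral, rotated -1]) auto
      then show ?thesis
        unfolding abs_summable_on_def .
    qed
    have "(LINT D|count_space \<D>. ?in w (cen D) (rad D)) = (\<Sum>D\<in>?S. ?in w (cen D) (rad D))"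
      using lebesgue_integral_count_space_finite_support[of \<D> "\<lambda>D. ?in w (cen D) (rad D)"] fin
      unfolding S by simp
    also have "\<dots> = of_nat (card ?S)"
      by simp
    also have "of_nat (card ?S) = ?in w c0 r0"
    proof (cases "w \<in> ball c0 r0")
      case True
      moreover have "w \<notin> X" using w q by auto
      ultimately obtain D where "D \<in> ?S"
        by (auto simp: X_def)
      then have "?S = {D}"
        using uniq by blast
      with True show ?thesis by simp
    next
      case False
      moreover have "w \<notin> X" using w q by auto
      ultimately have "w \<notin> cball c0 r0"
        using outer_circle_subset by auto
      then have "?S = {}"
        using sub by blast
      then have "card ?S = 0"
        by (simp only: card.empty)
      with False show ?thesis
        by (simp only: of_nat_0 if_False)
    qed
    finally show "(LINT D|count_space \<D>. ?in w (cen D) (rad D)) = ?in w c0 r0" .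
  qed
  have "(LINT D|count_space \<D>. contour_integral (circlepath (cen D) (rad D)) ?f)
      = (LINT D|count_space \<D>. 2 * pi * \<i> * (\<Sum>w\<in>?Z. ?in w (cen D) (rad D) * residue ?f w))"
  proof (rule Bochner_Integration.integral_cong)
    fix D assume "D \<in> space (count_space \<D>)"
    then have "D \<in> \<D>" by simp
    then show "contour_integral (circlepath (cen D) (rad D)) ?f
        = 2 * pi * \<i> * (\<Sum>w\<in>?Z. ?in w (cen D) (rad D) * residue ?f w)"
      by (intro CI rad inner_circle_subset)
  qed (rule refl)
  also have "\<dots> = 2 * pi * \<i> * (LINT D|count_space \<D>. (\<Sum>w\<in>?Z. ?in w (cen D) (rad D) * residue ?f w))"
    by (rule integral_mult_right_zero)
  also have "(LINT D|count_space \<D>. (\<Sum>w\<in>?Z. ?in w (cen D) (rad D) * residue ?f w))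
     = (\<Sum>w\<in>?Z. LINT D|count_space \<D>. ?in w (cen D) (rad D) * residue ?f w)"
    by (rule Bochner_Integration.integral_sum) (intro integrable_mult_left int)
  also have "\<dots> = (\<Sum>w\<in>?Z. ?in w c0 r0 * residue ?f w)"
    by (intro sum.cong refl) (subst integral_mult_left_zero, simp only: count)
  also have "2 * pi * \<i> * \<dots> = contour_integral (circlepath c0 r0) ?f"
    by (rule CI[symmetric, OF r0 outer_circle_subset])
  finally show "bint ?f = 0"
    by (simp add: bint_def)
qed

text \<open>
  This expresses that the boundary measure charges every ball that meets a boundary circle. A bump
  function alone would not do, because infinitely many other circles may pass through its support;
  they are eliminated by concentrating the bump on the chosen circle.
\<close>

lemma bint_nonzero:
  assumes circle: "(c, r) = (c0, r0) \<or> (\<exists>D\<in>\<D>. (c, r) = (cen D, rad D))"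
    and b: "b \<in> sphere c r" "b \<in> ball a e"
  shows "\<exists>f. continuous_on X f \<and> (\<forall>z. z \<notin> ball a e \<longrightarrow> f z = 0) \<and> bint f \<noteq> 0"
proof -
  have r: "r > 0"
    using circle r0 rad by auto
  define \<psi> where "\<psi> = (\<lambda>z. complex_of_real (max 0 (e - dist a z)) * cnj (z - c))"
  define F where "F = (\<lambda>(k::nat) z. \<psi> z * of_real (max 0 (1 - real k * \<bar>dist c z - r\<bar>)))"
  define I where "I = contour_integral (circlepath c r) \<psi>"
  have cont: "continuous_on UNIV \<psi>"
    unfolding \<psi>_def by (intro continuous_intros)
  have "I \<noteq> 0"
    unfolding I_def \<psi>_def
    by (rule circle_integral_weight_nonzero[OF r _ _ b(1)])
       (use b(2) in \<open>auto intro!: continuous_intros\<close>)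
  have contF: "continuous_on X (F k)" for k
    unfolding F_def by (intro continuous_intros continuous_on_subset[OF cont]) auto
  have lim: "(\<lambda>k. contour_integral (circlepath c' r') (F k)) \<longlonglongrightarrow> (if (c', r') = (c, r) then I else 0)"
    if "r' > 0" for c' r'
    unfolding F_def I_def by (rule tendsto_circle_integral_spike[OF r that cont])
  have "bounded (\<psi> ` X)"
    using continuous_on_subset[OF cont] compact_X
    by (intro compact_imp_bounded compact_continuous_image) auto
  then obtain B where B: "\<And>z. z \<in> X \<Longrightarrow> cmod (\<psi> z) \<le> B"
    by (auto simp: bounded_iff)
  have FB: "cmod (F k z) \<le> B" if "z \<in> X" for k z
  proof -
    have "cmod (F k z) = cmod (\<psi> z) * \<bar>max 0 (1 - real k * \<bar>dist c z - r\<bar>)\<bar>"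
      by (simp add: F_def norm_mult)
    also have "\<dots> \<le> cmod (\<psi> z) * 1"
      by (intro mult_left_mono) auto
    finally show ?thesis
      using B[OF that] by simp
  qed
  have limLINT: "(\<lambda>k. LINT D|count_space \<D>. contour_integral (circlepath (cen D) (rad D)) (F k))
     \<longlonglongrightarrow> (LINT D|count_space \<D>. (if (cen D, rad D) = (c, r) then I else 0))"
  proof (rule integral_dominated_convergence[where w = "\<lambda>D. B * (2 * pi) * rad D"])
    show "integrable (count_space \<D>) (\<lambda>D. B * (2 * pi) * rad D)"
      using summable by simp
    show "AE D in count_space \<D>. (\<lambda>k. contour_integral (circlepath (cen D) (rad D)) (F k))
        \<longlonglongrightarrow> (if (cen D, rad D) = (c, r) then I else 0)"
      by (rule AE_I2) (use lim rad in simp)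
    show "AE D in count_space \<D>. cmod (contour_integral (circlepath (cen D) (rad D)) (F k))
        \<le> B * (2 * pi) * rad D" for k
    proof (rule AE_I2)
      fix D assume "D \<in> space (count_space \<D>)"
      then have D: "D \<in> \<D>" by simp
      have "cmod (contour_integral (circlepath (cen D) (rad D)) (F k)) \<le> B * (2 * pi * rad D)"
        using inner_circle_subset[OF D] continuous_on_subset[OF contF]
        by (intro circle_integral_bound rad D FB) auto
      then show "cmod (contour_integral (circlepath (cen D) (rad D)) (F k)) \<le> B * (2 * pi) * rad D"
        by (simp add: mult.assoc)
    qed
  qed simp_all
  let ?L = "(if (c0, r0) = (c, r) then I else 0)
      - (LINT D|count_space \<D>. (if (cen D, rad D) = (c, r) then I else 0))"
  have limit: "(\<lambda>k. bint (F k)) \<longlonglongrightarrow> ?L"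
    unfolding bint_def by (intro tendsto_diff lim r0 limLINT)
  \<comment> \<open>The chosen circle occurs exactly once among all the boundary circles, so one of the two terms of the
    limit is \<open>I\<close> and the other is \<open>0\<close>.\<close>
  have "?L \<noteq> 0"
  proof (cases "(c, r) = (c0, r0)")
    case True
    then have "(LINT D|count_space \<D>. (if (cen D, rad D) = (c, r) then I else 0))
         = (LINT D|count_space \<D>. 0)"
      using proper by (intro Bochner_Integration.integral_cong) auto
    with True \<open>I \<noteq> 0\<close> show ?thesis by simp
  next
    case False
    with circle obtain E where E: "E \<in> \<D>" "(c, r) = (cen E, rad E)"
      by blast
    have "D = E" if "D \<in> \<D>" "(cen D, rad D) = (c, r)" for D
      using disj[OF that(1) E(1)] E(2) that(2) r by auto
    then have S: "{D \<in> \<D>. (if (cen D, rad D) = (c, r) then I else 0) \<noteq> 0} = {E}"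
      using E \<open>I \<noteq> 0\<close> by auto
    have "(LINT D|count_space \<D>. (if (cen D, rad D) = (c, r) then I else 0)) = I"
      by (subst lebesgue_integral_count_space_finite_support, unfold S) (use E in auto)
    with False \<open>I \<noteq> 0\<close> show ?thesis by auto
  qed
  have "\<exists>k. bint (F k) \<noteq> 0"
  proof (rule ccontr)
    assume "\<nexists>k. bint (F k) \<noteq> 0"
    with limit have "(\<lambda>_::nat. 0) \<longlonglongrightarrow> ?L"
      by (simp only: not_ex not_not)
    then have "0 = ?L"
      by (rule iffD1[OF LIMSEQ_const_iff])
    from \<open>?L \<noteq> 0\<close> this[symmetric] show False
      by (rule notE)
  qed
  then obtain k where "bint (F k) \<noteq> 0"
    by blast
  moreover have "F k z = 0" if "z \<notin> ball a e" for z
    using that by (simp add: F_def \<psi>_def)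
  ultimately show ?thesis
    using contF by blast
qed

text \<open>
  A ball is connected, so it cannot leave the large disc or enter a removed one without crossing the
  boundary circle.
\<close>

lemma ball_subset_X:
  assumes a: "a \<in> X" and e: "e > 0" and outer: "ball a e \<inter> sphere c0 r0 = {}"
    and inner: "\<And>D. D \<in> \<D> \<Longrightarrow> ball a e \<inter> sphere (cen D) (rad D) = {}"
  shows "ball a e \<subseteq> X"
proof -
  have "ball a e \<subseteq> cball c0 r0"
  proof (rule ccontr)
    assume "\<not> ball a e \<subseteq> cball c0 r0"
    moreover have "a \<in> ball a e \<inter> cball c0 r0"
      using a e by (simp add: X_def)
    ultimately have "ball a e \<inter> frontier (cball c0 r0) \<noteq> {}"
      by (intro connected_Int_frontier[OF connected_ball]) blast+
    with outer r0 show False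
      by simp
  qed
  moreover have "ball a e \<inter> ball (cen D) (rad D) = {}" if D: "D \<in> \<D>" for D
  proof (rule ccontr)
    assume "ball a e \<inter> ball (cen D) (rad D) \<noteq> {}"
    moreover have "a \<in> ball a e - ball (cen D) (rad D)"
      using a e D by (auto simp: X_def)
    ultimately have "ball a e \<inter> frontier (ball (cen D) (rad D)) \<noteq> {}"
      by (intro connected_Int_frontier[OF connected_ball]) blast+
    with inner[OF D] rad[OF D] show False
      by (simp add: frontier_ball)
  qed
  ultimately show ?thesis
    unfolding X_def by blast
qed

lemma essential_R_alg: "essential (top_of_set X) (R_alg X)"
proof (rule essential_R_algI[OF compact_X])
  fix a and e :: real
  assume a: "a \<in> X" and e: "e > 0"
  show "\<exists>\<Lambda> f. annihilator X \<Lambda> \<and> continuous_on X f \<and>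
      (\<forall>z. z \<notin> ball a e \<longrightarrow> f z = 0) \<and> \<Lambda> f \<noteq> 0"
  proof (cases "ball a e \<subseteq> X")
    case False
    then have "\<exists>c r. ((c, r) = (c0, r0) \<or> (\<exists>D\<in>\<D>. (c, r) = (cen D, rad D))) \<and>
        ball a e \<inter> sphere c r \<noteq> {}"
      using ball_subset_X[OF a e] by blast
    then obtain c r b where "(c, r) = (c0, r0) \<or> (\<exists>D\<in>\<D>. (c, r) = (cen D, rad D))"
      "b \<in> sphere c r" "b \<in> ball a e"
      by (elim exE conjE) blast
    from bint_nonzero[OF this] annihilator_bint show ?thesis
      by blast
  next
    case True
    define f where "f = (\<lambda>z. complex_of_real (max 0 (e - dist a z)) * cnj (z - a))"
    have "cball a (e / 2) \<subseteq> ball a e"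
      using e by auto
    with True have "annihilator X (contour_integral (circlepath a (e / 2)))"
      using e by (intro annihilator_circle_integral) auto
    moreover have "continuous_on X f"
      unfolding f_def by (intro continuous_intros)
    moreover have "f z = 0" if "z \<notin> ball a e" for z
      using that by (simp add: f_def)
    moreover have "contour_integral (circlepath a (e / 2)) f \<noteq> 0"
      unfolding f_def
      by (rule circle_integral_weight_nonzero[of _ _ _ "a + of_real (e / 2)"])
         (use e in \<open>auto intro!: continuous_intros simp: dist_norm\<close>)
    ultimately show ?thesis
      by blast
  qed
qed

end

section \<open>Essentiality for semiclassical Swiss cheese sets\<close>

lemma disc_radius_ball:
  assumes "r > 0"
  shows "disc_radius (ball c r) = r"
  unfolding disc_radius_def
  by (rule the_equality) (use assms in \<open>auto simp: ball_eq_ball_iff ball_eq_cball_iff\<close>)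

theorem theorem1p8:
  fixes X :: "complex set"
  assumes "semiclassical_swiss_cheese_set X"
  shows "uniform_algebra (top_of_set X) (R_alg X) \<and> essential (top_of_set X) (R_alg X)"
proof -
  obtain \<Delta> \<D> where "swiss_cheese (\<Delta>, \<D>)" "semiclassical (\<Delta>, \<D>)"
    and X: "X = \<Delta> - \<Union>\<D>"
    using assms by (auto simp: semiclassical_swiss_cheese_set_def cheese_set_def)
  then have "closed_disc \<Delta>" and open_disc: "\<And>D. D \<in> \<D> \<Longrightarrow> open_disc D"
    and disj: "disjoint \<D>" and proper: "\<And>D. D \<in> \<D> \<Longrightarrow> closure D \<subset> \<Delta>"
    and summable: "disc_radius summable_on \<D>"
    by (auto simp: swiss_cheese_def semiclassical_def)
  obtain c0 r0 where \<Delta>: "r0 > 0" "\<Delta> = cball c0 r0"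
    using \<open>closed_disc \<Delta>\<close> by (auto simp: closed_disc_def)
  have "\<exists>c. disc_radius D > 0 \<and> D = ball c (disc_radius D)" if "D \<in> \<D>" for D
    using open_disc[OF that] by (auto simp: open_disc_def disc_radius_ball)
  then obtain cen where cen: "\<And>D. D \<in> \<D> \<Longrightarrow> disc_radius D > 0"
      "\<And>D. D \<in> \<D> \<Longrightarrow> ball (cen D) (disc_radius D) = D"
    by metis
  interpret cheese_boundary c0 r0 \<D> cen disc_radius
  proof
    show "ball (cen D) (disc_radius D) \<subseteq> cball c0 r0" if "D \<in> \<D>" for D
      using proper[OF that] closure_subset[of D] by (simp add: cen that \<Delta>(2))
    show "(cen D, disc_radius D) \<noteq> (c0, r0)" if "D \<in> \<D>" for D
    proof
      assume "(cen D, disc_radius D) = (c0, r0)"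
      then have "D = ball c0 r0"
        using cen(2)[OF that] by simp
      with proper[OF that] \<Delta> show False
        by simp
    qed
    show "ball (cen D) (disc_radius D) \<inter> ball (cen E) (disc_radius E) = {}"
      if "D \<in> \<D>" "E \<in> \<D>" "D \<noteq> E" for D E
      using disj that by (auto simp: cen disjoint_def)
    have "Infinite_Sum.abs_summable_on disc_radius \<D>"
      using summable by (rule summable_on_cong[THEN iffD1, rotated]) (simp add: cen(1) less_imp_le)
    then show "integrable (count_space \<D>) disc_radius"
      unfolding abs_summable_equivalent abs_summable_on_def .
  qed (use \<Delta> cen in auto)
  have "cheese_boundary.X c0 r0 \<D> cen disc_radius = cball c0 r0 - \<Union>\<D>"
    unfolding X_def using cen(2) by simp
  with X \<Delta>(2) have "X = cheese_boundary.X c0 r0 \<D> cen disc_radius"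
    by simp
  with uniform_algebra_R_alg[OF compact_X] essential_R_alg show ?thesis
    by simp
qed

end
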